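(* Let $m\ge 0$ and $n\ge 1$ be integers and let $t_{-m}\le\ldots\le t_0\le t_1\le\ldots\le t_{n-1}\le t_n\le\ldots\le t_{n+m}$ be any non-decreasing sequence of real knots with $t_0<t_n$. Then the B-spline functions $N_{m,i}$ of degree $m$ over $[t_0,t_n]$ satisfy the following identities (in the variable $u$) for every $i$ with $-m\le i\le n-1$: $$mN_{m,i}(u)+(t_{m+i+1}-u)N'_{m,i}(u)=m(t_{m+i+1}-t_i)\frac{N_{m-1,i}(u)}{t_{m+i}-t_i}$$ and $$mN_{m,i}(u)+(t_i-u)N'_{m,i}(u)=m(t_{m+i+1}-t_i)\frac{N_{m-1,i+1}(u)}{t_{m+i+1}-t_{i+1}},$$ where, for any quantity $Q$, the quotient $Q/(t_k-t_\ell)$ is taken to be $0$ if the knots $t_k$ and $t_\ell$ are equal, and $N_{-1,k}\equiv 0$ for all $k$.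
   Context: B-spline functions: for an integer $0\le p\le m$ and $-p\le i<n$, the B-spline basis function of degree $p$ over $[t_0,t_n]$ built on the given knots is $N_{p,i}(u):=(t_{i+p+1}-t_i)\,[t_i,t_{i+1},\ldots,t_{i+p+1}]\,(t-u)_+^p$, where the generalized divided difference acts on the variable $t$, and the truncated power function is $(x-c)^p_+=(x-c)^p$ if $x\ge c$ and $0$ if $x<c$. The generalized divided difference $[x_0,\ldots,x_r]f$ is the coefficient of $x^r$ in the polynomial of degree at most $r$ that interpolates $f$ at $x_0,\ldots,x_r$ in the Hermite sense (a node repeated $s$ times means matching $f,f',\ldots,f^{(s-1)}$ there). Convention: $N_{p,q}\equiv 0$ if $q<-p$ or $q\ge n$. The prime denotes the derivative with respect to $u$. *)

theory Defs
  imports "HOL-Analysis.Analysis" "HOL-Computational_Algebra.Polynomial"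
begin

definition trunc_power :: "nat \<Rightarrow> real \<Rightarrow> real \<Rightarrow> real" where
  "trunc_power p x c = (if x \<ge> c then (x - c) ^ p else 0)"

text \<open>
  The derivative used in Hermite interpolation is taken from the right, so it is the ordinary
  derivative wherever that exists. The only place where this matters for B-splines is the
  \<open>p\<close>-th derivative of \<open>t \<mapsto> (t - u)\<^sub>+\<^sup>p\<close>, which has a jump at \<open>t = u\<close> and is needed there when
  \<open>u\<close> is a knot of multiplicity \<open>p + 1\<close>. Its right derivative is \<open>p! (t - u)\<^sub>+\<^sup>0\<close>, in accordance
  with the case \<open>x \<ge> c\<close> in the truncated power.
\<close>

definition right_deriv :: "(real \<Rightarrow> real) \<Rightarrow> real \<Rightarrow> real" where
  "right_deriv f x = vector_derivative f (at_right x)"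

definition hermite_interpolates :: "real list \<Rightarrow> (real \<Rightarrow> real) \<Rightarrow> real poly \<Rightarrow> bool" where
  "hermite_interpolates xs f P \<longleftrightarrow>
     (\<forall>x\<in>set xs. \<forall>j<count_list xs x. poly ((pderiv ^^ j) P) x = (right_deriv ^^ j) f x)"

text \<open>The nodes \<open>x\<^sub>0, \<dots>, x\<^sub>r\<close> form a list of length \<open>r + 1\<close>.\<close>

definition divided_difference :: "real list \<Rightarrow> (real \<Rightarrow> real) \<Rightarrow> real" where
  "divided_difference xs f =
     (let r = length xs - 1
      in coeff (THE P. degree P \<le> r \<and> hermite_interpolates xs f P) r)"

text \<open>
  Degrees and indices are integers, so that the conventions for \<open>N\<^sub>p\<^sub>,\<^sub>i\<close> with \<open>p = -1\<close>, \<open>i < -p\<close>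
  or \<open>i \<ge> n\<close> are part of the definition. The formula makes sense for every real \<open>u\<close>, but with these
  conventions it describes the B-splines over \<open>[t\<^sub>0, t\<^sub>n]\<close> only: for instance, the formula for
  \<open>i = -p - 1\<close> vanishes to the right of \<open>t\<^sub>0\<close> but in general not to the left of it.
\<close>

definition bspline :: "int \<Rightarrow> (int \<Rightarrow> real) \<Rightarrow> int \<Rightarrow> int \<Rightarrow> real \<Rightarrow> real" where
  "bspline n t p i u =
     (if p < 0 \<or> i < - p \<or> i \<ge> n then 0
      else (t (i + p + 1) - t i) *
           divided_difference (map t [i..i + p + 1]) (\<lambda>x. trunc_power (nat p) x u))"

end

theory Submission imports Defs begin

text \<open>
  With \<open>g = (t - u)\<^sub>+\<^sup>m\<^sup>-\<^sup>1\<close>, differentiation in \<open>u\<close> turns \<open>(t - u)\<^sub>+\<^sup>m = (t - u) g\<close> into \<open>- m g\<close>, and the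
  Leibniz rule gives \<open>[x\<^sub>0, \<dots>, x\<^sub>r, y] ((t - u) g) = (y - u) [x\<^sub>0, \<dots>, x\<^sub>r, y] g + [x\<^sub>0, \<dots>, x\<^sub>r] g\<close>.
  Taking for \<open>y\<close> the last or the first knot yields the two identities. When \<open>u\<close> is a knot, this
  computation is valid for the left derivative, and also for the right derivative once \<open>g\<close> is
  replaced by its limit from the right in \<open>u\<close>; if the B-spline is differentiable at \<open>u\<close>, either
  version may be used.
\<close>

section \<open>Hermite interpolation with prescribed data\<close>

text \<open>Induction on \<open>k\<close>: in characteristic zero, differentiation lowers the order
  of a root by exactly one.\<close>

lemma higher_pderiv_roots_iff:
  fixes P :: "'a::field_char_0 poly"
  shows "(\<forall>j<k. poly ((pderiv ^^ j) P) a = 0) \<longleftrightarrow> [:- a, 1:] ^ k dvd P"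
proof (induction k arbitrary: P)
  case (Suc k)
  have "(\<forall>j<Suc k. poly ((pderiv ^^ j) P) a = 0) \<longleftrightarrow> poly P a = 0 \<and> [:- a, 1:] ^ k dvd pderiv P"
    by (simp add: All_less_Suc2 funpow_Suc_right Suc.IH[symmetric] del: funpow.simps)
  also have "\<dots> \<longleftrightarrow> [:- a, 1:] ^ Suc k dvd P"
  proof (cases "poly P a = 0 \<and> P \<noteq> 0")
    case True
    hence "pderiv P \<noteq> 0"
      by (metis pderiv_iszero poly_pCons poly_0 add.right_neutral mult_zero_right pCons_0_0)
    moreover have "order a P \<noteq> 0"
      using True order_root[of P a] by auto
    ultimately have "order a P = Suc (order a (pderiv P))"
      using True by (metis order_pderiv)
    with True \<open>pderiv P \<noteq> 0\<close> show ?thesis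
      by (simp add: order_divides del: power_Suc)
  next
    case False
    thus ?thesis
      by (auto simp: order_divides order_root simp del: power_Suc)
  qed
  finally show ?case .
qed simp

text \<open>\<open>d j x\<close> is the prescribed value of the \<open>j\<close>-th derivative at \<open>x\<close>.\<close>

definition hermite_data :: "'a list \<Rightarrow> (nat \<Rightarrow> 'a \<Rightarrow> 'a) \<Rightarrow> 'a::field_char_0 poly \<Rightarrow> bool" where
  "hermite_data xs d P \<longleftrightarrow> (\<forall>x\<in>set xs. \<forall>j<count_list xs x. poly ((pderiv ^^ j) P) x = d j x)"

text \<open>A functional of prescribed values rather than of a function: this admits limits of data
  in \<open>u\<close>, which need not be right derivatives of the truncated power.\<close>

definition data_difference :: "'a list \<Rightarrow> (nat \<Rightarrow> 'a \<Rightarrow> 'a) \<Rightarrow> 'a::field_char_0" where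
  "data_difference xs d =
     (let r = length xs - 1 in coeff (THE P. degree P \<le> r \<and> hermite_data xs d P) r)"

definition node_poly :: "'a list \<Rightarrow> 'a::field_char_0 poly" where
  "node_poly xs = (\<Prod>x\<leftarrow>xs. [:- x, 1:])"

lemma node_poly_simps [simp]:
  "node_poly [] = 1" "node_poly (x # xs) = [:- x, 1:] * node_poly xs"
  by (simp_all add: node_poly_def)

lemma node_poly_nonzero [simp]: "node_poly xs \<noteq> 0"
  by (induction xs) (auto simp del: mult_pCons_left)

lemma degree_node_poly [simp]: "degree (node_poly xs) = length xs"
  by (induction xs) (auto simp: degree_mult_eq simp del: mult_pCons_left)

lemma coeff_node_poly [simp]: "coeff (node_poly xs) (length xs) = 1"
proof (induction xs)
  case (Cons x xs)
  thus ?case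
    using coeff_eq_0[of "node_poly xs" "Suc (length xs)"] by simp
qed simp

lemma proots_node_poly: "proots (node_poly xs) = mset xs"
  by (induction xs) (auto simp: proots_mult simp del: mult_pCons_left)

lemma order_node_poly: "order x (node_poly xs) = count_list xs x"
  using arg_cong[OF proots_node_poly, of "\<lambda>M. count M x" xs]
  by (simp add: count_mset)

text \<open>Zero data at a node mean a root of at least its multiplicity in \<open>xs\<close>. As an
  inclusion of multisets this can be counted against the degree.\<close>

lemma hermite_data_0_iff: "hermite_data xs (\<lambda>_ _. 0) P \<longleftrightarrow> P = 0 \<or> mset xs \<subseteq># proots P"
proof (cases "P = 0")
  case False
  have "hermite_data xs (\<lambda>_ _. 0) P \<longleftrightarrow> (\<forall>x\<in>set xs. count_list xs x \<le> order x P)"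
    using False by (simp add: hermite_data_def higher_pderiv_roots_iff order_divides)
  also have "\<dots> \<longleftrightarrow> mset xs \<subseteq># proots P"
    using False by (auto simp: subseteq_mset_def count_mset)
  finally show ?thesis using False by simp
qed (simp add: hermite_data_def)

lemma hermite_data_node_poly_mult: "hermite_data xs (\<lambda>_ _. 0) (node_poly xs * Q)"
  by (cases "Q = 0") (simp_all add: hermite_data_0_iff proots_mult proots_node_poly)

lemma hermite_data_add:
  "hermite_data xs d P \<Longrightarrow> hermite_data xs e Q \<Longrightarrow> hermite_data xs (\<lambda>j x. d j x + e j x) (P + Q)"
  by (simp add: hermite_data_def higher_pderiv_add)

lemma hermite_data_smult:
  "hermite_data xs d P \<Longrightarrow> hermite_data xs (\<lambda>j x. c * d j x) (smult c P)"
  by (simp add: hermite_data_def higher_pderiv_smult)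

lemma hermite_data_add_zero:
  "hermite_data xs d P \<Longrightarrow> hermite_data xs (\<lambda>_ _. 0) Q \<Longrightarrow> hermite_data xs d (P + Q)"
  using hermite_data_add[of xs d P "\<lambda>_ _. 0" Q] by simp

lemma hermite_data_unique:
  assumes "hermite_data xs d P" "hermite_data xs d Q" "degree P < length xs" "degree Q < length xs"
  shows "P = Q"
proof (rule ccontr)
  assume "P \<noteq> Q"
  have "hermite_data xs (\<lambda>_ _. 0) (P - Q)"
    using hermite_data_add[OF assms(1) hermite_data_smult[OF assms(2), of "-1"]] by simp
  with \<open>P \<noteq> Q\<close> have "mset xs \<subseteq># proots (P - Q)"
    by (simp add: hermite_data_0_iff)
  hence "length xs \<le> size (proots (P - Q))"
    using size_mset_mono by fastforce
  also have "\<dots> \<le> degree (P - Q)"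
    by (rule size_proots_le)
  also have "\<dots> < length xs"
    using assms(3,4) by (rule degree_diff_less)
  finally show False by simp
qed

text \<open>Newton's construction: a multiple of \<open>node_poly xs\<close> does not disturb the
  data at \<open>xs\<close>. It has \<open>y\<close> as a root of order exactly \<open>k\<close>, so
  its \<open>k\<close>-th derivative there is nonzero and a suitable factor \<open>c\<close>
  achieves the one new value.\<close>

lemma hermite_data_ex:
  assumes "xs \<noteq> []"
  shows "\<exists>P. degree P < length xs \<and> hermite_data xs d P"
  using assms
proof (induction xs rule: list_nonempty_induct)
  case (single x)
  show ?case
    by (rule exI[of _ "[:d 0 x:]"]) (simp add: hermite_data_def)
next
  case (cons y xs)
  then obtain P where P: "degree P < length xs" "hermite_data xs d P"
    by blast
  define k where "k = count_list xs y"
  have roots: "\<forall>j<k. poly ((pderiv ^^ j) (node_poly xs)) y = 0"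
    unfolding higher_pderiv_roots_iff by (simp add: order_divides order_node_poly k_def)
  have ne: "poly ((pderiv ^^ k) (node_poly xs)) y \<noteq> 0"
  proof
    assume "poly ((pderiv ^^ k) (node_poly xs)) y = 0"
    with roots have "\<forall>j<Suc k. poly ((pderiv ^^ j) (node_poly xs)) y = 0"
      by (simp add: less_Suc_eq)
    thus False
      unfolding higher_pderiv_roots_iff
      by (simp add: order_divides order_node_poly k_def del: power_Suc)
  qed
  define c where "c = (d k y - poly ((pderiv ^^ k) P) y) / poly ((pderiv ^^ k) (node_poly xs)) y"
  define R where "R = P + smult c (node_poly xs)"
  have "hermite_data xs d R"
    unfolding R_def using hermite_data_node_poly_mult[of xs "[:c:]"]
    by (intro hermite_data_add_zero[OF P(2)]) simp
  moreover have "poly ((pderiv ^^ k) R) y = d k y"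
    using ne by (simp add: R_def c_def higher_pderiv_add higher_pderiv_smult)
  moreover have "poly ((pderiv ^^ j) R) y = d j y" if "j < k" for j
    using \<open>hermite_data xs d R\<close> that
    by (cases "y \<in> set xs") (auto simp: hermite_data_def k_def)
  ultimately have "hermite_data (y # xs) d R"
    by (auto simp: hermite_data_def k_def less_Suc_eq)
  moreover have "degree R < length (y # xs)"
    using P(1) unfolding R_def by (intro degree_add_less) (auto intro: le_less_trans[OF degree_smult_le])
  ultimately show ?case by blast
qed

section \<open>Divided differences of prescribed data\<close>

lemma data_difference_eq:
  assumes "hermite_data xs d P" "degree P < length xs"
  shows "data_difference xs d = coeff P (length xs - 1)"
proof -
  have "degree Q \<le> length xs - 1 \<longleftrightarrow> degree Q < length xs" for Q :: "'a poly"
    using assms(2) by auto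
  hence "(THE P. degree P \<le> length xs - 1 \<and> hermite_data xs d P) = P"
    using assms by (intro the_equality) (auto intro: hermite_data_unique)
  thus ?thesis by (simp add: data_difference_def)
qed

lemma data_difference_eq_0:
  assumes "hermite_data xs d P" "Suc (degree P) < length xs"
  shows "data_difference xs d = 0"
  using data_difference_eq[OF assms(1)] assms(2) by (simp add: coeff_eq_0)

lemma data_difference_cong:
  assumes "\<And>j x. x \<in> set xs \<Longrightarrow> d j x = e j x"
  shows "data_difference xs d = data_difference xs e"
proof -
  have "hermite_data xs d = hermite_data xs e"
    by (intro ext) (simp add: hermite_data_def assms)
  thus ?thesis by (simp add: data_difference_def)
qed

text \<open>Allows the last knot to be moved to the head of the list, where
  \<open>data_difference_leibniz\<close> splits off a node.\<close>

lemma data_difference_perm: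
  assumes "mset xs = mset ys"
  shows "data_difference xs = data_difference ys"
proof -
  have "set xs = set ys" "length xs = length ys"
    using assms by (rule mset_eq_setD, rule mset_eq_length)
  moreover have "count_list xs = count_list ys"
    using arg_cong[OF assms, of count] by (simp add: fun_eq_iff count_mset)
  ultimately show ?thesis
    by (simp add: fun_eq_iff data_difference_def hermite_data_def)
qed

text \<open>The \<open>c j x\<close> are top coefficients of the Hermite basis polynomials. As they
  do not depend on \<open>d\<close>, data with a parameter can be differentiated term by
  term.\<close>

lemma data_difference_linear:
  assumes "xs \<noteq> []"
  shows "\<exists>c. \<forall>d. data_difference xs d = (\<Sum>x\<in>set xs. \<Sum>j<count_list xs x. c j x * d j x)"
proof -
  define \<delta> where "\<delta> j x = (\<lambda>j' x'. if j' = j \<and> x' = x then 1 else 0 :: 'a)" for j :: nat and x :: 'a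
  have "\<forall>j x. \<exists>P. degree P < length xs \<and> hermite_data xs (\<delta> j x) P"
    using hermite_data_ex[OF assms] by blast
  then obtain B where B: "\<And>j x. degree (B j x) < length xs" "\<And>j x. hermite_data xs (\<delta> j x) (B j x)"
    by metis
  have "data_difference xs d = (\<Sum>x\<in>set xs. \<Sum>j<count_list xs x. coeff (B j x) (length xs - 1) * d j x)" for d
  proof -
    define P where "P = (\<Sum>x\<in>set xs. \<Sum>j<count_list xs x. smult (d j x) (B j x))"
    have "degree P < length xs"
      unfolding P_def using B(1) assms
      by (intro degree_sum_less) (auto intro: le_less_trans[OF degree_smult_le])
    moreover have "hermite_data xs d P"
      unfolding hermite_data_def
    proof (intro ballI allI impI)
      fix y k assume y: "y \<in> set xs" "k < count_list xs y"
      have "poly ((pderiv ^^ k) P) y = (\<Sum>x\<in>set xs. \<Sum>j<count_list xs x. d j x * \<delta> j x k y)"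
        using B(2) y
        by (simp add: P_def higher_pderiv_sum poly_sum higher_pderiv_smult hermite_data_def)
      also have "\<dots> = (\<Sum>x\<in>set xs. if x = y then d k y else 0)"
        using y by (intro sum.cong refl) (auto simp: \<delta>_def if_distrib cong: if_cong)
      also have "\<dots> = d k y"
        using y by simp
      finally show "poly ((pderiv ^^ k) P) y = d k y" .
    qed
    ultimately show ?thesis
      by (subst data_difference_eq) (auto simp: P_def coeff_sum mult.commute)
  qed
  thus ?thesis by (intro exI allI)
qed

section \<open>The Leibniz rule for a linear factor\<close>

text \<open>Only the first derivative of the linear factor survives. At \<open>j = 0\<close> the
  truncated \<open>j - 1\<close> is harmless because of the factor \<open>of_nat j\<close>.\<close>

lemma higher_pderiv_linear_mult:
  "poly ((pderiv ^^ j) ([:- u, 1:] * P)) x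
     = (x - u) * poly ((pderiv ^^ j) P) x + of_nat j * poly ((pderiv ^^ (j - 1)) P) x"
  for P :: "'a::field_char_0 poly"
proof (induction j arbitrary: P)
  case (Suc j)
  have "pderiv ([:- u, 1:] * P) = P + [:- u, 1:] * pderiv P"
    by (simp add: pderiv_mult pderiv_pCons del: mult_pCons_left)
  moreover have "of_nat j * poly ((pderiv ^^ (j - 1)) (pderiv P)) x = of_nat j * poly ((pderiv ^^ j) P) x"
    by (cases j) (simp_all add: funpow_Suc_right del: funpow.simps)
  ultimately show ?case
    by (simp add: funpow_Suc_right higher_pderiv_add Suc.IH ring_distribs del: funpow.simps mult_pCons_left)
qed (simp add: algebra_simps)

text \<open>If \<open>P\<close> interpolates \<open>d\<close>, then \<open>[:- u, 1:] * P\<close>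
  interpolates the product data, but its degree may be one too high. Subtracting
  \<open>smult a (node_poly (y # xs))\<close> corrects the degree and keeps the data.\<close>

lemma data_difference_leibniz:
  assumes "xs \<noteq> []"
  shows "data_difference (y # xs) (\<lambda>j x. (x - u) * d j x + of_nat j * d (j - 1) x)
           = (y - u) * data_difference (y # xs) d + data_difference xs d"
proof -
  obtain P where P: "degree P < length (y # xs)" "hermite_data (y # xs) d P"
    using hermite_data_ex[of "y # xs" d] by blast
  define a where "a = coeff P (length xs)"
  define Q where "Q = P - smult a (node_poly xs)"
  \<comment> \<open>The corrected product, expressed through the interpolant \<open>Q\<close> of
    \<open>d\<close> at \<open>xs\<close>. In degree \<open>length xs\<close>, the first summand
    contributes \<open>data_difference xs d\<close> and the second
    \<open>(y - u) * a\<close>.\<close>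
  define R where "R = [:- u, 1:] * Q + smult ((y - u) * a) (node_poly xs)"
  have Q_eq: "Q = P + node_poly xs * [:- a:]"
    by (simp add: Q_def)
  have "hermite_data xs d P"
    using P(2) by (auto simp: hermite_data_def)
  hence Q: "hermite_data xs d Q"
    unfolding Q_eq by (rule hermite_data_add_zero) (rule hermite_data_node_poly_mult)
  have deg_Q: "degree Q < length xs"
  proof -
    have "degree Q \<le> length xs"
      unfolding Q_def using P(1) by (intro degree_diff_le) auto
    moreover have "coeff Q (length xs) = 0"
      by (simp add: Q_def a_def)
    ultimately show ?thesis using assms
      by (metis leading_coeff_0_iff degree_0 length_0_conv nat_less_le)
  qed
  have R_eq: "R = [:- u, 1:] * P + node_poly (y # xs) * [:- a:]"
    by (simp add: R_def Q_def algebra_simps smult_diff_left smult_diff_right smult_add_right)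
  have "hermite_data (y # xs) (\<lambda>j x. (x - u) * d j x + of_nat j * d (j - 1) x) ([:- u, 1:] * P)"
    unfolding hermite_data_def higher_pderiv_linear_mult
  proof (intro ballI allI impI)
    fix x j assume "x \<in> set (y # xs)" "j < count_list (y # xs) x"
    with P(2) have "poly ((pderiv ^^ j) P) x = d j x" "poly ((pderiv ^^ (j - 1)) P) x = d (j - 1) x"
      by (simp_all only: hermite_data_def less_imp_diff_less)
    thus "(x - u) * poly ((pderiv ^^ j) P) x + of_nat j * poly ((pderiv ^^ (j - 1)) P) x
        = (x - u) * d j x + of_nat j * d (j - 1) x"
      by (simp only:)
  qed
  hence R: "hermite_data (y # xs) (\<lambda>j x. (x - u) * d j x + of_nat j * d (j - 1) x) R"
    unfolding R_eq by (rule hermite_data_add_zero) (rule hermite_data_node_poly_mult)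
  have "degree ([:- u, 1:] * Q) \<le> length xs"
    using degree_mult_le[of "[:- u, 1:]" Q] deg_Q by simp
  hence "degree R < length (y # xs)"
    unfolding R_def by (auto intro!: degree_add_less le_less_trans[OF degree_smult_le] simp del: mult_pCons_left)
  hence "data_difference (y # xs) (\<lambda>j x. (x - u) * d j x + of_nat j * d (j - 1) x)
           = coeff R (length xs)"
    using data_difference_eq[OF R] by simp
  also have "\<dots> = coeff Q (length xs - 1) + (y - u) * a"
    using assms deg_Q by (cases xs) (simp_all add: R_def coeff_eq_0)
  finally show ?thesis
    using data_difference_eq[OF Q deg_Q] data_difference_eq[OF P(2,1)] by (simp add: a_def)
qed

section \<open>Data of the truncated power\<close>

text \<open>
  The derivatives in \<open>x\<close> of \<open>x \<mapsto> (x - u) ^ p\<close> cut off outside \<open>A\<close>; they vanish for \<open>j > p\<close> because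
  \<open>p choose j = 0\<close>. The set \<open>A\<close> is kept independent of \<open>u\<close>, so that the data are smooth in \<open>u\<close>;
  \<open>A = {u..}\<close> gives the truncated power, and \<open>A = {u<..}\<close> its limit from the right in \<open>u\<close>.
\<close>

definition trunc_data :: "real set \<Rightarrow> nat \<Rightarrow> real \<Rightarrow> nat \<Rightarrow> real \<Rightarrow> real" where
  "trunc_data A p u j x = (if x \<in> A then fact j * of_nat (p choose j) * (x - u) ^ (p - j) else 0)"

lemma poly_higher_pderiv_linear_power:
  "poly ((pderiv ^^ j) ([:- u, 1:] ^ p)) x = fact j * of_nat (p choose j) * (x - u) ^ (p - j)"
  for x :: real
proof (induction p arbitrary: j)
  case 0
  show ?case by (cases j) (simp_all add: funpow_Suc_right del: funpow.simps)
next
  case (Suc p)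
  show ?case
  proof (cases j)
    case (Suc k)
    have "(x - u) * (of_nat (p choose Suc k) * (x - u) ^ (p - Suc k))
            = of_nat (p choose Suc k) * (x - u) ^ (p - k)"
    proof (cases "k < p")
      case True
      hence "p - k = Suc (p - Suc k)" by simp
      thus ?thesis by simp
    qed simp
    thus ?thesis
      unfolding power_Suc[of "[:- u, 1:]"] higher_pderiv_linear_mult Suc.IH
      by (simp add: Suc algebra_simps)
  qed (simp add: higher_pderiv_linear_mult Suc.IH algebra_simps del: mult_pCons_left)
qed

lemma trunc_data_eq_poly:
  "trunc_data A p u j x = (if x \<in> A then poly ((pderiv ^^ j) ([:- u, 1:] ^ p)) x else 0)"
  by (simp add: trunc_data_def poly_higher_pderiv_linear_power)

lemma trunc_data_Suc:
  "trunc_data A (Suc p) u j x = (x - u) * trunc_data A p u j x + of_nat j * trunc_data A p u (j - 1) x"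
  unfolding trunc_data_eq_poly power_Suc by (simp add: higher_pderiv_linear_mult del: mult_pCons_left)

lemma trunc_data_has_field_derivative:
  "((\<lambda>v. trunc_data A p v j x) has_field_derivative - of_nat p * trunc_data A (p - 1) u j x) (at u)"
proof -
  \<comment> \<open>Absorption identity: it trades the exponent \<open>p - j\<close> brought down by
    the derivative for the factor \<open>p\<close>. For \<open>p = 0\<close> both sides
    vanish.\<close>
  have *: "of_nat (p choose j) * of_nat (p - j) = (of_nat p * of_nat (p - 1 choose j) :: real)"
  proof (cases p)
    case (Suc q)
    show ?thesis
      using binomial_absorb_comp[of p j] by (metis of_nat_mult mult.commute)
  qed simp
  have "((\<lambda>v. (x - v) ^ (p - j)) has_field_derivative - (of_nat (p - j) * (x - u) ^ (p - 1 - j))) (at u)"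
    by (auto intro!: derivative_eq_intros)
  hence "((\<lambda>v. fact j * of_nat (p choose j) * (x - v) ^ (p - j)) has_field_derivative
      fact j * of_nat (p choose j) * - (of_nat (p - j) * (x - u) ^ (p - 1 - j))) (at u)"
    by (rule DERIV_cmult)
  also have "fact j * of_nat (p choose j) * - (of_nat (p - j) * (x - u) ^ (p - 1 - j))
      = - fact j * (of_nat (p choose j) * of_nat (p - j)) * (x - u) ^ (p - 1 - j)"
    by (simp only: mult_ac mult_minus_left mult_minus_right)
  finally show ?thesis
    unfolding trunc_data_def * by (cases "x \<in> A") (simp_all add: mult_ac)
qed

text \<open>At \<open>x\<close> and just to the right of it, membership in \<open>{u..}\<close> is
  constant, so each right derivative is that of a polynomial. At \<open>x = u\<close> this relies on
  the half-line being closed.\<close>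

lemma higher_right_deriv_trunc_power:
  "(right_deriv ^^ j) (\<lambda>x. trunc_power p x u) = trunc_data {u..} p u j"
proof (induction j)
  case 0
  show ?case by (simp add: fun_eq_iff trunc_power_def trunc_data_def)
next
  case (Suc j)
  have "right_deriv (trunc_data {u..} p u j) x = trunc_data {u..} p u (Suc j) x" for x
  proof -
    define P where "P = (if u \<le> x then (pderiv ^^ j) ([:- u, 1:] ^ p) else 0)"
    have P: "(poly P has_field_derivative trunc_data {u..} p u (Suc j) x) (at x within {x<..})"
    proof -
      have "poly (pderiv P) x = trunc_data {u..} p u (Suc j) x"
        by (simp add: P_def trunc_data_eq_poly)
      thus ?thesis
        using has_field_derivative_at_within[OF poly_DERIV[of P x]] by simp
    qed
    have eq: "trunc_data {u..} p u j y = poly P y" if "u \<le> x \<longleftrightarrow> u \<le> y" for y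
      using that by (simp add: trunc_data_eq_poly P_def)
    have "eventually (\<lambda>y. u \<le> x \<longleftrightarrow> u \<le> y) (at_right x)"
    proof (cases "u \<le> x")
      case True
      thus ?thesis by (auto simp: eventually_at_filter)
    next
      case False
      hence "eventually (\<lambda>y. y < u) (at_right x)"
        by (intro order_tendstoD(2)[OF tendsto_ident_at]) auto
      thus ?thesis using False by (auto elim: eventually_mono)
    qed
    hence "eventually (\<lambda>y. trunc_data {u..} p u j y = poly P y) (at_right x)"
      by eventually_elim (rule eq)
    hence "(trunc_data {u..} p u j has_field_derivative trunc_data {u..} p u (Suc j) x) (at_right x)"
      using P eq[OF refl] by (subst has_field_derivative_cong_eventually) auto
    thus ?thesis
      unfolding right_deriv_def has_real_derivative_iff_has_vector_derivative
      by (intro vector_derivative_within) (auto simp: trivial_limit_at_right_real)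
  qed
  thus ?case by (simp add: Suc.IH fun_eq_iff)
qed

lemma divided_difference_trunc_power:
  "divided_difference xs (\<lambda>x. trunc_power p x u) = data_difference xs (trunc_data {u..} p u)"
  by (simp add: divided_difference_def data_difference_def hermite_interpolates_def
    hermite_data_def higher_right_deriv_trunc_power)

lemma data_difference_trunc_data_cong:
  assumes "A \<inter> set xs = B \<inter> set xs"
  shows "data_difference xs (trunc_data A p u) = data_difference xs (trunc_data B p u)"
  using assms by (intro data_difference_cong) (auto simp: trunc_data_def)

text \<open>The data come from a single polynomial, \<open>(x - u) ^ p\<close> or 0, whose degree
  lies below the coefficient that is read off.\<close>

lemma data_difference_trunc_data_eq_0:
  assumes "length xs > Suc p" "set xs \<subseteq> A \<or> set xs \<inter> A = {}"
  shows "data_difference xs (trunc_data A p u) = 0"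
proof (cases "set xs \<subseteq> A")
  case True
  hence "hermite_data xs (trunc_data A p u) ([:- u, 1:] ^ p)"
    by (auto simp: hermite_data_def trunc_data_eq_poly)
  thus ?thesis
    using assms(1) by (intro data_difference_eq_0) (auto simp: degree_linear_power)
next
  case False
  hence "hermite_data xs (trunc_data A p u) 0"
    using assms(2) by (auto simp: hermite_data_def trunc_data_def)
  thus ?thesis
    using assms(1) by (intro data_difference_eq_0) auto
qed

section \<open>Differentiation in \<open>u\<close> and its one-sided versions\<close>

text \<open>With \<open>A\<close> held fixed, \<open>data_difference_linear\<close> gives a finite
  sum of polynomials in \<open>v\<close>, so no \<open>u\<close> is exceptional.\<close>

lemma data_difference_trunc_data_has_field_derivative:
  assumes "xs \<noteq> []"
  shows "((\<lambda>v. data_difference xs (trunc_data A p v)) has_field_derivative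
           - of_nat p * data_difference xs (trunc_data A (p - 1) u)) (at u)"
proof -
  obtain c where c: "\<And>d. data_difference xs d = (\<Sum>x\<in>set xs. \<Sum>j<count_list xs x. c j x * d j x)"
    using data_difference_linear[OF assms] by blast
  have "((\<lambda>v. \<Sum>x\<in>set xs. \<Sum>j<count_list xs x. c j x * trunc_data A p v j x) has_field_derivative
      (\<Sum>x\<in>set xs. \<Sum>j<count_list xs x. c j x * (- of_nat p * trunc_data A (p - 1) u j x))) (at u)"
    by (intro DERIV_sum DERIV_cmult trunc_data_has_field_derivative)
  thus ?thesis
    by (simp only: c sum_distrib_left mult.left_commute)
qed

text \<open>Limits along \<open>F\<close> determine the values at \<open>u\<close>, and then the
  difference quotients. With \<open>F\<close> one-sided, agreement on one side of \<open>u\<close>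
  suffices.\<close>

lemma field_derivative_unique_filter:
  fixes f g :: "real \<Rightarrow> real"
  assumes "(f has_field_derivative a) (at u)" "(g has_field_derivative b) (at u)"
    and "eventually (\<lambda>v. f v = g v) F" "F \<le> at u" "F \<noteq> bot"
  shows "f u = g u" "a = b"
proof -
  have "(f \<longlongrightarrow> f u) F" "(g \<longlongrightarrow> g u) F"
    using DERIV_isCont[OF assms(1)] DERIV_isCont[OF assms(2)] assms(4)
    by (auto simp: isCont_def intro: tendsto_mono)
  thus eq: "f u = g u"
    using tendsto_unique[OF assms(5)] by (simp add: tendsto_cong[OF assms(3)])
  have "((\<lambda>v. (f v - f u) / (v - u)) \<longlongrightarrow> a) F" "((\<lambda>v. (g v - g u) / (v - u)) \<longlongrightarrow> b) F"
    using assms(1,2,4) by (auto simp: has_field_derivative_iff intro: tendsto_mono)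
  moreover have ev: "eventually (\<lambda>v. (f v - f u) / (v - u) = (g v - g u) / (v - u)) F"
    using assms(3) by eventually_elim (simp add: eq)
  ultimately show "a = b"
    using tendsto_unique[OF assms(5)] by (simp add: tendsto_cong[OF ev])
qed

text \<open>The B-spline without its factor of a knot distance; the cut now moves with
  \<open>u\<close>.\<close>

definition trunc_difference :: "nat \<Rightarrow> real list \<Rightarrow> real \<Rightarrow> real" where
  "trunc_difference p xs u = data_difference xs (trunc_data {u..} p u)"

lemma trunc_difference_differentiable:
  assumes "u \<notin> set xs" "xs \<noteq> []"
  shows "trunc_difference p xs differentiable at u"
proof -
  have "eventually (\<lambda>v. \<forall>x\<in>set xs. v \<le> x \<longleftrightarrow> u \<le> x) (nhds u)"
  proof (intro eventually_ball_finite ballI finite_set)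
    fix x assume "x \<in> set xs"
    with assms(1) have "u \<noteq> x" by auto
    hence "u < x \<or> x < u" by linarith
    thus "eventually (\<lambda>v. v \<le> x \<longleftrightarrow> u \<le> x) (nhds u)"
    proof
      assume "u < x"
      hence "eventually (\<lambda>v. v < x) (nhds u)"
        using eventually_nhds_in_open[of "{..<x}" u] by simp
      thus ?thesis by eventually_elim (use \<open>u < x\<close> in auto)
    next
      assume "x < u"
      hence "eventually (\<lambda>v. v > x) (nhds u)"
        using eventually_nhds_in_open[of "{x<..}" u] by simp
      thus ?thesis by eventually_elim (use \<open>x < u\<close> in auto)
    qed
  qed
  hence "eventually (\<lambda>v. trunc_difference p xs v = data_difference xs (trunc_data {u..} p v)) (nhds u)"
    unfolding trunc_difference_def
    by eventually_elim (rule data_difference_trunc_data_cong, auto)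
  hence "(trunc_difference p xs has_field_derivative
           - of_nat p * data_difference xs (trunc_data {u..} (p - 1) u)) (at u)"
    using data_difference_trunc_data_has_field_derivative[OF assms(2)]
    by (subst DERIV_cong_ev[OF refl _ refl])
  thus ?thesis
    unfolding real_differentiable_def by (rule exI)
qed

text \<open>For \<open>v\<close> slightly to the left of \<open>u\<close>, the cut at
  \<open>v\<close> selects the nodes in \<open>{u..}\<close>; slightly to the right, those in
  \<open>{u<..}\<close>. Each \<open>A\<close> is therefore paired with its one-sided
  filter.\<close>

lemma trunc_difference_derivative:
  assumes "(trunc_difference p xs has_field_derivative D) (at u)" "xs \<noteq> []"
    and "A = {u..} \<or> A = {u<..}"
  shows "trunc_difference p xs u = data_difference xs (trunc_data A p u)"
    and "D = - of_nat p * data_difference xs (trunc_data A (p - 1) u)"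
proof -
  define F where "F = (if A = {u..} then at_left u else at_right u)"
  have F: "F \<le> at u" "F \<noteq> bot"
    by (auto simp: F_def at_le trivial_limit_at_left_real trivial_limit_at_right_real)
  have "eventually (\<lambda>v. \<forall>x\<in>set xs. v \<le> x \<longleftrightarrow> x \<in> A) F"
  proof (intro eventually_ball_finite ballI finite_set)
    fix x assume "x \<in> set xs"
    show "eventually (\<lambda>v. v \<le> x \<longleftrightarrow> x \<in> A) F"
    proof (cases "A = {u..}")
      case True
      have "eventually (\<lambda>v. v < u) (at_left u)" by (simp add: eventually_at_filter)
      moreover have "eventually (\<lambda>v. x < v) (at_left u)" if "x < u"
        using that by (intro order_tendstoD(1)[OF tendsto_ident_at])
      ultimately show ?thesis
        using True by (cases "x < u") (auto simp: F_def elim: eventually_mono)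
    next
      case False
      hence A: "A = {u<..}" "F = at_right u"
        using assms(3) by (simp_all add: F_def)
      have "eventually (\<lambda>v. u < v) (at_right u)" by (simp add: eventually_at_filter)
      moreover have "eventually (\<lambda>v. v < x) (at_right u)" if "u < x"
        using that by (intro order_tendstoD(2)[OF tendsto_ident_at])
      ultimately show ?thesis
        unfolding A by (cases "u < x") (auto elim: eventually_mono)
    qed
  qed
  hence ev: "eventually (\<lambda>v. trunc_difference p xs v = data_difference xs (trunc_data A p v)) F"
    unfolding trunc_difference_def
    by eventually_elim (rule data_difference_trunc_data_cong, auto)
  show "trunc_difference p xs u = data_difference xs (trunc_data A p u)"
    and "D = - of_nat p * data_difference xs (trunc_data A (p - 1) u)"
    by (rule field_derivative_unique_filter[OF assms(1)
      data_difference_trunc_data_has_field_derivative[OF assms(2)] ev F])+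
qed

text \<open>For \<open>p > 0\<close>, splitting off \<open>y\<close> by the Leibniz rule produces
  the term \<open>(y - u) * data_difference xs (trunc_data A (p - 1) u)\<close>, which
  \<open>(y - u) * D\<close> cancels.\<close>

lemma trunc_difference_identity:
  assumes "(trunc_difference p xs has_field_derivative D) (at u)"
    and "mset xs = add_mset y (mset ys)" "ys \<noteq> []" "A = {u..} \<or> A = {u<..}"
  shows "of_nat p * trunc_difference p xs u + (y - u) * D
           = of_nat p * data_difference ys (trunc_data A (p - 1) u)"
proof (cases p)
  case 0
  have "xs \<noteq> []" using assms(2) by auto
  thus ?thesis using 0 trunc_difference_derivative(2)[OF assms(1) _ assms(4)] by simp
next
  case (Suc q)
  have ne: "xs \<noteq> []" using assms(2) by auto
  have "data_difference xs = data_difference (y # ys)"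
    using assms(2) by (intro data_difference_perm) simp
  moreover have "trunc_data A (Suc q) u = (\<lambda>j x. (x - u) * trunc_data A q u j x + of_nat j * trunc_data A q u (j - 1) x)"
    by (intro ext trunc_data_Suc)
  ultimately have "data_difference xs (trunc_data A (Suc q) u)
      = (y - u) * data_difference xs (trunc_data A q u) + data_difference ys (trunc_data A q u)"
    using data_difference_leibniz[OF assms(3), of y u "trunc_data A q u"] by (simp only:)
  with trunc_difference_derivative(1)[OF assms(1) ne assms(4)]
  have "trunc_difference p xs u
      = (y - u) * data_difference xs (trunc_data A q u) + data_difference ys (trunc_data A q u)"
    by (simp only: Suc)
  moreover have "D = - of_nat p * data_difference xs (trunc_data A q u)"
    using trunc_difference_derivative(2)[OF assms(1) ne assms(4)] by (simp add: Suc)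
  ultimately show ?thesis
    by (simp only: Suc diff_Suc_1) (simp add: algebra_simps)
qed

section \<open>B-splines and the two identities\<close>

lemma bspline_eq_trunc_difference:
  assumes "- p \<le> i" "i < n" "0 \<le> p"
  shows "bspline n t p i u =
    (t (i + p + 1) - t i) * trunc_difference (nat p) (map t [i..i + p + 1]) u"
  using assms by (simp add: bspline_def trunc_difference_def divided_difference_trunc_power)

text \<open>If the end knots coincide, the quotient is 0 by the convention for division. By
  monotonicity all nodes are then equal, no cut separates them, and the divided difference is 0 as
  well.\<close>

lemma bspline_divide_support:
  assumes "- p \<le> k" "k < n" "0 \<le> p" "mono_on {k..k + p + 1} t"
  shows "bspline n t p k u / (t (k + p + 1) - t k)
    = data_difference (map t [k..k + p + 1]) (trunc_data {u..} (nat p) u)"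
proof (cases "t (k + p + 1) = t k")
  case True
  define xs where "xs = map t [k..k + p + 1]"
  have eq: "t j = t k" if "j \<in> {k..k + p + 1}" for j
  proof (rule antisym)
    show "t j \<le> t k"
      unfolding True[symmetric] using that assms(3) by (intro mono_onD[OF assms(4)]) auto
    show "t k \<le> t j"
      using that assms(3) by (intro mono_onD[OF assms(4)]) auto
  qed
  have "set xs \<subseteq> {t k}"
    unfolding xs_def set_map set_upto by (intro image_subsetI) (simp only: eq singleton_iff)
  moreover have "{t k} \<subseteq> {u..} \<or> {t k} \<inter> {u..} = {}"
    by simp
  ultimately have "set xs \<subseteq> {u..} \<or> set xs \<inter> {u..} = {}"
    by blast
  moreover have "length xs > Suc (nat p)"
    using assms(3) by (simp add: xs_def)
  ultimately show ?thesis
    unfolding xs_def[symmetric] using True by (simp add: data_difference_trunc_data_eq_0)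
next
  case False
  thus ?thesis
    unfolding bspline_eq_trunc_difference[OF assms(1-3)] by (simp add: trunc_difference_def)
qed

text \<open>At a knot the B-spline may fail to be differentiable, so the identities are claimed
  wherever the derivative exists, which covers every \<open>u\<close> that is not one of its knots.
  The range of \<open>u\<close> is where the conventions for missing indices fit the
  formula.\<close>

theorem lemma3p1:
  fixes m n i :: int and t :: "int \<Rightarrow> real" and u :: real
  assumes "m \<ge> 0" and "n \<ge> 1"
    and "mono_on {- m..n + m} t"
    and "t 0 < t n"
    and "- m \<le> i" and "i \<le> n - 1"
    and "u \<in> {t 0..t n}"
  shows "(u \<notin> t ` {i..i + m + 1} \<longrightarrow> bspline n t m i differentiable (at u)) \<and>
    (bspline n t m i differentiable (at u) \<longrightarrow>
      of_int m * bspline n t m i u + (t (m + i + 1) - u) * deriv (bspline n t m i) u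
        = of_int m * (t (m + i + 1) - t i) * (bspline n t (m - 1) i u / (t (m + i) - t i)) \<and>
      of_int m * bspline n t m i u + (t i - u) * deriv (bspline n t m i) u
        = of_int m * (t (m + i + 1) - t i) *
            (bspline n t (m - 1) (i + 1) u / (t (m + i + 1) - t (i + 1))))"
proof -
  define T where "T = t (i + m + 1)"
  define xs where "xs = map t [i..i + m + 1]"
  define p where "p = nat m"
  have m: "of_int m = (of_nat p :: real)" and p1: "nat (m - 1) = p - 1"
    using assms(1) by (simp_all add: p_def nat_diff_distrib)
  have ne: "xs \<noteq> []"
    using assms(1) by (simp add: xs_def)
  have N: "bspline n t m i = (\<lambda>v. (T - t i) * trunc_difference p xs v)"
    using assms by (simp add: fun_eq_iff bspline_eq_trunc_difference T_def xs_def p_def)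
  have "bspline n t m i differentiable (at u)" if "u \<notin> t ` {i..i + m + 1}"
    unfolding N using that ne
    by (intro differentiable_mult differentiable_const trunc_difference_differentiable) (auto simp: xs_def)
  moreover have
    "of_nat p * bspline n t m i u + (T - u) * deriv (bspline n t m i) u
        = of_nat p * (T - t i) * (bspline n t (m - 1) i u / (t (i + m) - t i)) \<and>
     of_nat p * bspline n t m i u + (t i - u) * deriv (bspline n t m i) u
        = of_nat p * (T - t i) * (bspline n t (m - 1) (i + 1) u / (T - t (i + 1)))"
    if diff: "bspline n t m i differentiable (at u)"
  proof (cases "T = t i")
    case True
    thus ?thesis by (simp add: N)
  next
    case False
    have "trunc_difference p xs = (\<lambda>v. bspline n t m i v * inverse (T - t i))"
      using False by (simp add: N fun_eq_iff)
    hence "trunc_difference p xs differentiable (at u)"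
      using diff by (auto intro!: differentiable_mult)
    then obtain D where D: "(trunc_difference p xs has_field_derivative D) (at u)"
      by (auto simp: real_differentiable_def)
    have dN: "deriv (bspline n t m i) u = (T - t i) * D"
      unfolding N by (intro DERIV_imp_deriv DERIV_cmult D)
    show ?thesis
    proof (cases "p = 0")
      case True
      thus ?thesis
        using trunc_difference_derivative(2)[OF D ne, of "{u..}"] by (simp add: dN)
    next
      case False
      hence "1 \<le> m" by (simp add: p_def)
      define ys zs where "ys = map t [i..i + m]" and "zs = map t [i + 1..i + m + 1]"
      have xs_ys: "xs = ys @ [T]"
        using assms(1) upto_rec2[of i "i + m + 1"] by (simp add: xs_def ys_def T_def)
      have xs_zs: "xs = t i # zs"
        using assms(1) upto_rec1[of i "i + m + 1"] by (simp add: xs_def zs_def)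
      have xs: "mset xs = add_mset T (mset ys)" "mset xs = add_mset (t i) (mset zs)"
        by (simp add: xs_ys, simp add: xs_zs)
      have ne': "ys \<noteq> []" "zs \<noteq> []"
        using assms(1) by (simp_all add: ys_def zs_def)
      have len: "length ys > Suc (p - 1)" "length zs > Suc (p - 1)"
        using \<open>1 \<le> m\<close> by (simp_all add: ys_def zs_def p_def)
      have mono: "t j \<le> t k" if "- m \<le> j" "j \<le> k" "k \<le> n + m" for j k
        using mono_onD[OF assms(3), of j k] that by simp
      have "of_nat p * trunc_difference p xs u + (T - u) * D
          = of_nat p * (bspline n t (m - 1) i u / (t (i + m) - t i))"
      proof (cases "i = - m")
        \<comment> \<open>The convention \<open>N\<^sub>m\<^sub>-\<^sub>1\<^sub>,\<^sub>-\<^sub>m = 0\<close> can disagree with the formula at \<open>u = t 0\<close>,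
            so the version from the right is needed.\<close>
        case True
        have "set ys \<inter> {u<..} = {}"
        proof -
          have "t j \<le> u" if "j \<in> {i..i + m}" for j
            using mono[of j 0] that True assms(2,7) by auto
          thus ?thesis by (force simp: ys_def)
        qed
        hence "data_difference ys (trunc_data {u<..} (p - 1) u) = 0"
          using len(1) by (intro data_difference_trunc_data_eq_0) auto
        thus ?thesis
          using trunc_difference_identity[OF D xs(1) ne'(1), of "{u<..}"] True
          by (simp add: bspline_def)
      next
        case False
        have "mono_on {i..i + (m - 1) + 1} t"
          using assms(5,6) by (intro mono_onI mono) auto
        hence "bspline n t (m - 1) i u / (t (i + m) - t i) = data_difference ys (trunc_data {u..} (p - 1) u)"
          using bspline_divide_support[of "m - 1" i n t u] False \<open>1 \<le> m\<close> assms(5,6)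
          by (simp add: ys_def p1)
        thus ?thesis
          using trunc_difference_identity[OF D xs(1) ne'(1), of "{u..}"] by simp
      qed
      moreover have "of_nat p * trunc_difference p xs u + (t i - u) * D
          = of_nat p * (bspline n t (m - 1) (i + 1) u / (T - t (i + 1)))"
      proof -
        have "bspline n t (m - 1) (i + 1) u / (T - t (i + 1))
            = data_difference zs (trunc_data {u..} (p - 1) u)"
        proof (cases "i = n - 1")
          case True
          \<comment> \<open>These knots are \<open>t n\<close> and its successors. The closed
            half-line contains them even at \<open>u = t n\<close>, so the version from the left
            already agrees with the convention for index \<open>n\<close>.\<close>
          have "set zs \<subseteq> {u..}"
          proof -
            have "u \<le> t j" if "j \<in> {i + 1..i + m + 1}" for j
              using mono[of n j] that True assms(1,2,7) by auto
            thus ?thesis by (auto simp: zs_def)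
          qed
          hence "data_difference zs (trunc_data {u..} (p - 1) u) = 0"
            using len(2) by (intro data_difference_trunc_data_eq_0) auto
          thus ?thesis
            using True by (simp add: bspline_def)
        next
          case False
          have "mono_on {i + 1..i + 1 + (m - 1) + 1} t"
            using assms(5,6) by (intro mono_onI mono) auto
          thus ?thesis
            using bspline_divide_support[of "m - 1" "i + 1" n t u] False \<open>1 \<le> m\<close> assms(5,6)
            by (simp add: zs_def p1 T_def)
        qed
        thus ?thesis
          using trunc_difference_identity[OF D xs(2) ne'(2), of "{u..}"] by simp
      qed
      \<comment> \<open>Multiplication by \<open>c = T - t i\<close> turns the identities for
        \<open>trunc_difference\<close> into those for the B-spline.\<close>
      moreover have "a * (c * f) + b * (c * d) = a * c * x" if "a * f + b * d = a * x"
        for a b c d f x :: real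
        using that by algebra
      ultimately show ?thesis
        unfolding dN unfolding N by blast
    qed
  qed
  moreover have "m + i + 1 = i + m + 1" "m + i = i + m"
    by simp_all
  ultimately show ?thesis
    by (simp only: m flip: T_def) blast
qed

end
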